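(* Suppose $\lambda\in(|B_l|,|B_{l+1}|)\cap(0,1)$ with $l\geq 2$. Then there is a $C^{k+1}$ function $p\colon\mathbb{T}^k\to\mathbb{R}$ satisfying: for each $i\in\{1,\dots,l\}$ there exists $\sigma_i$ such that $(g_i)_{\sigma_i}\neq 0$. Moreover, the set of functions $p$ satisfying this property is an open and dense subset of $C^{k+1}(\mathbb{T}^k,\mathbb{R})$ in the $C^{k+1}$ topology.
   Context: Let $k>2$ and let $A$ be an Anosov (hyperbolic linear) automorphism of $\mathbb{T}^k=\mathbb{R}^k/\mathbb{Z}^k$ with $k$ distinct real eigenvalues satisfying $|B_1|<|B_2|<\cdots<|B_j|<1<|B_{j+1}|<\cdots<|B_k|$, whose respective eigenvectors $v_1,\dots,v_k$ form a basis of $\mathbb{R}^k$. Let $0<\lambda<1$; the skew product under consideration is $F(x,y)=(Ax,\lambda y+p(x))$ on $\mathbb{T}^k\times\mathbb{R}$. Fix a base point $\underline{t}\in\mathbb{T}^k$. For $p\colon\mathbb{T}^k\to\mathbb{R}$ and $i\in\{1,\dots,k\}$ put $q_i(t)=p(tv_i+\underline{t})$, $t\in\mathbb{R}$. Fourier coefficients: for $a\in\mathbb{R}$, $(q_i)_a=\lim_{T\to\infty}\frac{1}{2T}\int_{-T}^{T}q_i(t)e^{-\mathrm{i}at}\,dt$. The Fourier coefficients of the formal series $g_i(t)=\sum_{n=-\infty}^{\infty}\lambda^n q_i(B_i^{-n}t)$ are defined, for $\sigma\in\mathbb{R}\setminus\{0\}$, by $$(g_i)_\sigma:=\sum_{n=-\infty}^{\infty}\lambda^n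 (q_i)_{\sigma B_i^{n}} .$$ *)

theory Defs
  imports "HOL-Analysis.Analysis"
begin

definition integer_vec :: "real^'n \<Rightarrow> bool" where
  "integer_vec z \<longleftrightarrow> (\<forall>i. z $ i \<in> \<int>)"

lemma integer_vec_simps:
  "integer_vec 0"
  "integer_vec x \<Longrightarrow> integer_vec y \<Longrightarrow> integer_vec (x + y)"
  "integer_vec x \<Longrightarrow> integer_vec y \<Longrightarrow> integer_vec (x - y)"
  "integer_vec x \<Longrightarrow> integer_vec (- x)"
  by (auto simp: integer_vec_def)

definition torus_rel :: "real^'n \<Rightarrow> real^'n \<Rightarrow> bool" where
  "torus_rel x y \<longleftrightarrow> integer_vec (x - y)"

lemma equivp_torus_rel: "equivp (torus_rel :: real^'n \<Rightarrow> real^'n \<Rightarrow> bool)"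
proof (rule equivpI)
  show "reflp (torus_rel :: real^'n \<Rightarrow> real^'n \<Rightarrow> bool)"
    by (rule reflpI) (simp add: torus_rel_def integer_vec_simps)
  show "symp (torus_rel :: real^'n \<Rightarrow> real^'n \<Rightarrow> bool)"
    by (rule sympI) (metis torus_rel_def integer_vec_simps(4) minus_diff_eq)
  show "transp (torus_rel :: real^'n \<Rightarrow> real^'n \<Rightarrow> bool)"
  proof (rule transpI)
    fix x y z :: "real^'n"
    assume "torus_rel x y" "torus_rel y z"
    then show "torus_rel x z"
      using integer_vec_simps(2)[of "x - y" "y - z"] by (simp add: torus_rel_def)
  qed
qed

text \<open>The torus \<open>\<real>\<^sup>k / \<int>\<^sup>k\<close>, where \<open>k = CARD('n)\<close>; \<open>to_torus\<close> is the canonical projection.\<close>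

quotient_type (overloaded) 'n torus = "real^('n::finite)" / torus_rel
  by (rule equivp_torus_rel)

lift_definition to_torus :: "real^'n \<Rightarrow> 'n::finite torus" is "\<lambda>x. x" .

instantiation torus :: (finite) ab_group_add
begin

lift_definition zero_torus :: "'a torus" is 0 .

lift_definition plus_torus :: "'a torus \<Rightarrow> 'a torus \<Rightarrow> 'a torus" is "(+)"
  by (metis torus_rel_def integer_vec_simps(2) add_diff_add)

lift_definition minus_torus :: "'a torus \<Rightarrow> 'a torus \<Rightarrow> 'a torus" is "(-)"
  by (metis (no_types, opaque_lifting) torus_rel_def integer_vec_simps(3) diff_diff_eq2
      diff_add_eq add.commute diff_diff_eq)

lift_definition uminus_torus :: "'a torus \<Rightarrow> 'a torus" is uminus
  by (metis torus_rel_def integer_vec_simps(4) minus_diff_minus)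

instance
  by standard
    (transfer; simp add: torus_rel_def integer_vec_simps algebra_simps)+

end

lemma to_torus_eq_iff: "to_torus x = to_torus y \<longleftrightarrow> integer_vec (x - y)"
  by transfer (simp add: torus_rel_def)

lemma to_torus_surj: "\<exists>x. to_torus x = u"
  by transfer (metis torus_rel_def integer_vec_simps(1) diff_self)

lemma to_torus_add: "to_torus (x + y) = to_torus x + to_torus y"
  by transfer (simp add: torus_rel_def integer_vec_simps)

definition partial_deriv :: "'n \<Rightarrow> (real^'n \<Rightarrow> real) \<Rightarrow> real^'n \<Rightarrow> real" where
  "partial_deriv i f = (\<lambda>x. frechet_derivative f (at x) (axis i 1))"

text \<open>The mixed partial derivative, of order \<open>length is\<close>, along the list of coordinates \<open>is\<close>.\<close>

definition iter_partial :: "'n list \<Rightarrow> (real^'n \<Rightarrow> real) \<Rightarrow> real^'n \<Rightarrow> real" where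
  "iter_partial is f = foldr partial_deriv is f"

definition C_diff :: "nat \<Rightarrow> (real^'n \<Rightarrow> real) \<Rightarrow> bool" where
  "C_diff m f \<longleftrightarrow>
     (\<forall>is x. length is < m \<longrightarrow> iter_partial is f differentiable (at x)) \<and>
     (\<forall>is. length is \<le> m \<longrightarrow> continuous_on UNIV (iter_partial is f))"

text \<open>Functions on the torus are differentiated through their \<open>\<int>\<^sup>k\<close>-periodic lifts.\<close>

definition C_torus :: "nat \<Rightarrow> ('n::finite torus \<Rightarrow> real) set" where
  "C_torus m = {p. C_diff m (\<lambda>x. p (to_torus x))}"

text \<open>\<open>C_close m \<epsilon> p q\<close>: all partial derivatives of order at most \<open>m\<close> of \<open>p\<close> and \<open>q\<close>
  are uniformly \<open>\<epsilon>\<close>-close. These relations give the neighbourhoods of the \<open>C\<^sup>m\<close> topology.\<close>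

definition C_close :: "nat \<Rightarrow> real \<Rightarrow> ('n::finite torus \<Rightarrow> real) \<Rightarrow> ('n torus \<Rightarrow> real) \<Rightarrow> bool" where
  "C_close m \<epsilon> p q \<longleftrightarrow>
     (\<forall>is x. length is \<le> m \<longrightarrow>
        \<bar>iter_partial is (\<lambda>y. p (to_torus y)) x - iter_partial is (\<lambda>y. q (to_torus y)) x\<bar> < \<epsilon>)"

definition C_topology :: "nat \<Rightarrow> ('n::finite torus \<Rightarrow> real) topology" where
  "C_topology m = topology (\<lambda>U. U \<subseteq> C_torus m \<and>
     (\<forall>p\<in>U. \<exists>\<epsilon>>0. \<forall>q\<in>C_torus m. C_close m \<epsilon> p q \<longrightarrow> q \<in> U))"

lemma C_close_mono: "C_close m \<epsilon> p q \<Longrightarrow> \<epsilon> \<le> \<delta> \<Longrightarrow> C_close m \<delta> p q"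
  unfolding C_close_def by (meson less_le_trans)

lemma openin_C_topology:
  fixes U :: "('n::finite torus \<Rightarrow> real) set"
  shows "openin (C_topology m) U \<longleftrightarrow> U \<subseteq> C_torus m \<and>
     (\<forall>p\<in>U. \<exists>\<epsilon>>0. \<forall>q\<in>C_torus m. C_close m \<epsilon> p q \<longrightarrow> q \<in> U)"
proof -
  have "istopology (\<lambda>U :: ('n torus \<Rightarrow> real) set. U \<subseteq> C_torus m \<and>
     (\<forall>p\<in>U. \<exists>\<epsilon>>0. \<forall>q\<in>C_torus m. C_close m \<epsilon> p q \<longrightarrow> q \<in> U))"
    unfolding istopology_def
  proof (intro conjI allI impI)
    fix S T :: "('n torus \<Rightarrow> real) set"
    assume S: "S \<subseteq> C_torus m \<and>
        (\<forall>p\<in>S. \<exists>\<epsilon>>0. \<forall>q\<in>C_torus m. C_close m \<epsilon> p q \<longrightarrow> q \<in> S)"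
      and T: "T \<subseteq> C_torus m \<and>
        (\<forall>p\<in>T. \<exists>\<epsilon>>0. \<forall>q\<in>C_torus m. C_close m \<epsilon> p q \<longrightarrow> q \<in> T)"
    show "S \<inter> T \<subseteq> C_torus m" using S by blast
    show "\<forall>p\<in>S \<inter> T. \<exists>\<epsilon>>0. \<forall>q\<in>C_torus m. C_close m \<epsilon> p q \<longrightarrow> q \<in> S \<inter> T"
    proof
      fix p assume "p \<in> S \<inter> T"
      then obtain d e where de: "d > 0" "\<forall>q\<in>C_torus m. C_close m d p q \<longrightarrow> q \<in> S"
          "e > 0" "\<forall>q\<in>C_torus m. C_close m e p q \<longrightarrow> q \<in> T"
        using S T by (metis IntD1 IntD2)
      have "\<forall>q\<in>C_torus m. C_close m (min d e) p q \<longrightarrow> q \<in> S \<inter> T"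
        using de by (meson C_close_mono IntI min.cobounded1 min.cobounded2)
      moreover have "min d e > 0" using de by simp
      ultimately show "\<exists>\<epsilon>>0. \<forall>q\<in>C_torus m. C_close m \<epsilon> p q \<longrightarrow> q \<in> S \<inter> T" by blast
    qed
  next
    fix K :: "('n torus \<Rightarrow> real) set set"
    assume K: "\<forall>S\<in>K. S \<subseteq> C_torus m \<and>
        (\<forall>p\<in>S. \<exists>\<epsilon>>0. \<forall>q\<in>C_torus m. C_close m \<epsilon> p q \<longrightarrow> q \<in> S)"
    show "\<Union> K \<subseteq> C_torus m" using K by blast
    show "\<forall>p\<in>\<Union> K. \<exists>\<epsilon>>0. \<forall>q\<in>C_torus m. C_close m \<epsilon> p q \<longrightarrow> q \<in> \<Union> K"
      using K by (meson UnionE UnionI)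
  qed
  then show ?thesis
    by (simp add: C_topology_def topology_inverse')
qed

lemma topspace_C_topology: "topspace (C_topology m) = C_torus m"
proof
  show "topspace (C_topology m) \<subseteq> C_torus m"
    using openin_C_topology openin_topspace by blast
  have "openin (C_topology m) (C_torus m)"
    by (auto simp: openin_C_topology intro: exI[of _ 1])
  then show "C_torus m \<subseteq> topspace (C_topology m)"
    by (rule openin_subset)
qed

text \<open>The matrices of the hyperbolic linear automorphisms of the torus: elements of
  \<open>GL(k, \<int>)\<close> without (complex) eigenvalues on the unit circle.\<close>

definition anosov_matrix :: "real^'n^'n \<Rightarrow> bool" where
  "anosov_matrix A \<longleftrightarrow>
     (\<forall>a b. A $ a $ b \<in> \<int>) \<and> \<bar>det A\<bar> = 1 \<and>
     (\<forall>z w. w \<noteq> 0 \<and> (\<chi> a b. complex_of_real (A $ a $ b)) *v w = z *s w \<longrightarrow> cmod z \<noteq> 1)"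

definition line_restriction ::
    "('n::finite torus \<Rightarrow> real) \<Rightarrow> 'n torus \<Rightarrow> real^'n \<Rightarrow> real \<Rightarrow> real" where
  "line_restriction p t0 w = (\<lambda>t. p (to_torus (t *\<^sub>R w) + t0))"

definition fourier_coeff :: "(real \<Rightarrow> real) \<Rightarrow> real \<Rightarrow> complex" where
  "fourier_coeff q a =
     Lim at_top (\<lambda>T::real. complex_of_real (1 / (2 * T)) *
       integral {-T..T} (\<lambda>t. complex_of_real (q t) * exp (- (\<i> * complex_of_real (a * t)))))"

text \<open>The coefficient at frequency \<open>\<sigma>\<close> of the formal series
  \<open>\<Sum>n. \<lambda>\<^sup>n q (B\<^sup>-\<^sup>n t)\<close>, \<open>n\<close> ranging over all integers.\<close>

definition series_fourier_coeff :: "real \<Rightarrow> real \<Rightarrow> (real \<Rightarrow> real) \<Rightarrow> real \<Rightarrow> complex" where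
  "series_fourier_coeff lam B q \<sigma> =
     (\<Sum>\<^sub>\<infinity>n::int. complex_of_real (lam powi n) * fourier_coeff q (\<sigma> * B powi n))"

end

theory Submission
  imports Defs
begin

text \<open>
  Fix an index \<open>i \<le> l\<close> and write \<open>B\<close>, \<open>w\<close> for the eigenvalue \<open>B i\<close> and the eigenvector \<open>v i\<close>.
  The ordering of the eigenvalues gives \<open>\<bar>B\<bar> < lam\<close>, and \<open>B\<close> is nonzero because the matrix is
  invertible. For each frequency \<open>\<sigma> \<noteq> 0\<close> the map \<open>\<Lambda>\<^sub>\<sigma>\<close>, which sends \<open>p\<close> to the coefficient of the
  formal series at \<open>\<sigma>\<close>, is a linear functional, and it is continuous already in the \<open>C\<^sup>1\<close> norm.
  Once this is known, the set of \<open>p\<close> with some \<open>\<Lambda>\<^sub>\<sigma> p \<noteq> 0\<close> is open as a union of open sets. It is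
  dense because one function \<open>h\<close> with \<open>\<Lambda>\<^sub>\<sigma> h \<noteq> 0\<close> suffices: if \<open>\<Lambda>\<^sub>\<sigma> p = 0\<close>, then
  \<open>\<Lambda>\<^sub>\<sigma> (p + c h) = c \<Lambda>\<^sub>\<sigma> h \<noteq> 0\<close> for arbitrarily small \<open>c\<close>. For \<open>h\<close> one takes the cosine of a single
  coordinate in which \<open>w\<close> does not vanish, centred at the base point; its restriction to the line is
  a cosine of some frequency \<open>\<omega>\<close>, and only the term \<open>n = 0\<close> of the series contributes at \<open>\<sigma> = \<omega>\<close>
  (\<open>series_fourier_coeff_wave\<close>). The set in the theorem is the intersection of these open dense sets
  over finitely many \<open>i\<close>, so it is open and dense too, and in particular not empty.

  The analytic content is the continuity of \<open>\<Lambda>\<^sub>\<sigma>\<close>. The coefficients of the restriction \<open>q\<close> of \<open>p\<close> to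
  a line exist because \<open>q\<close> is almost periodic: by the theorem of Stone and Weierstrass, \<open>p\<close> is a
  uniform limit of trigonometric polynomials (\<open>almost_periodic_on_line\<close>,
  \<open>almost_periodic_has_mean\<close>). They are bounded by \<open>sup \<bar>q\<bar>\<close>, and integration by parts bounds the
  coefficient at \<open>a\<close> by \<open>sup \<bar>q'\<bar> / \<bar>a\<bar>\<close> (\<open>fourier_coeff_decay\<close>). The first bound makes the terms
  \<open>n \<ge> 0\<close> of the series decay like \<open>lam\<^sup>n\<close>. The second one, at the frequency \<open>\<sigma> B\<^sup>n\<close>, makes the terms
  \<open>n < 0\<close> decay like \<open>(\<bar>B\<bar> / lam)\<^sup>k\<close> with \<open>k = - n\<close> (\<open>series_term_bound\<close>). So the series converges
  absolutely, with a bound proportional to the \<open>C\<^sup>1\<close> norm of \<open>p\<close>.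
\<close>

section \<open>Mean values of functions on the line\<close>

definition has_mean :: "(real \<Rightarrow> complex) \<Rightarrow> complex \<Rightarrow> bool" where
  "has_mean f L \<longleftrightarrow>
     ((\<lambda>T. complex_of_real (1 / (2 * T)) * integral {-T..T} f) \<longlongrightarrow> L) at_top"

lemma continuous_integrable_interval:
  fixes f :: "real \<Rightarrow> complex"
  assumes "continuous_on UNIV f"
  shows "f integrable_on {a..b}"
  by (meson assms continuous_on_subset integrable_continuous_interval subset_UNIV)

lemma has_mean_add:
  assumes "continuous_on UNIV f" "continuous_on UNIV g" "has_mean f L" "has_mean g M"
  shows "has_mean (\<lambda>t. f t + g t) (L + M)"
  using tendsto_add[OF assms(3,4)[unfolded has_mean_def]]
  by (simp add: has_mean_def integral_add continuous_integrable_interval assms distrib_left)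

lemma has_mean_cmult:
  assumes "has_mean f L"
  shows "has_mean (\<lambda>t. c * f t) (c * L)"
  using tendsto_mult_left[OF assms[unfolded has_mean_def], of c]
  by (simp add: has_mean_def mult.left_commute)

text \<open>Means over finite intervals are already bounded by the sup norm; the same estimate, applied to a
  difference of functions, later compares their means uniformly in the length of the interval.\<close>

lemma mean_norm_le:
  assumes "continuous_on UNIV f" "\<And>t. norm (f t) \<le> M" "T > 0"
  shows "norm (complex_of_real (1 / (2 * T)) * integral {-T..T} f) \<le> M"
proof -
  have "norm (integral {-T..T} f) \<le> M * (T - (-T))"
    by (rule integral_bound) (use assms in \<open>auto intro: continuous_on_subset\<close>)
  with assms(3) show ?thesis
    by (simp add: norm_mult norm_divide field_simps)
qed

lemma has_mean_norm_le:
  assumes "continuous_on UNIV f" "\<And>t. norm (f t) \<le> M" "has_mean f L"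
  shows "norm L \<le> M"
proof -
  have "eventually (\<lambda>T. norm (complex_of_real (1 / (2 * T)) * integral {-T..T} f) \<le> M) at_top"
    using eventually_gt_at_top[of 0] by eventually_elim (rule mean_norm_le[OF assms(1,2)])
  then show ?thesis
    using tendsto_norm[OF assms(3)[unfolded has_mean_def]]
    by (intro tendsto_upperbound) auto
qed

text \<open>The primitive \<open>exp (\<i> \<theta> t) / (\<i> \<theta>)\<close> of a nonconstant exponential is bounded, so its
  integral over an interval of length \<open>2 T\<close> does not grow with \<open>T\<close>.\<close>

lemma has_mean_exp:
  "has_mean (\<lambda>t. exp (\<i> * of_real (\<theta> * t))) (if \<theta> = 0 then 1 else 0)"
proof (cases "\<theta> = 0")
  case True
  have "eventually (\<lambda>T. complex_of_real (1 / (2 * T)) * integral {-T..T} (\<lambda>t. 1) = 1) at_top"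
    using eventually_gt_at_top[of 0]
    by eventually_elim (simp add: scaleR_conv_of_real)
  then show ?thesis
    using True by (simp add: has_mean_def tendsto_eventually)
next
  case False
  define e where "e = (\<lambda>t. exp (\<i> * of_real (\<theta> * t)))"
  have e: "norm (e t) = 1" for t
    by (simp add: e_def)
  have int: "integral {-T..T} e = (e T - e (-T)) / (\<i> * \<theta>)" if "T > 0" for T
  proof -
    have "((\<lambda>t. e t / (\<i> * \<theta>)) has_vector_derivative e t) (at t within {-T..T})" for t
      unfolding e_def has_real_derivative_iff_has_vector_derivative
      using False
      by (auto intro!: derivative_eq_intros has_vector_derivative_real_field simp: algebra_simps)
    then have "(e has_integral (e T / (\<i> * \<theta>) - e (-T) / (\<i> * \<theta>))) {-T..T}"
      using that by (intro fundamental_theorem_of_calculus) auto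
    then show ?thesis
      by (simp add: integral_unique diff_divide_distrib)
  qed
  have "norm (complex_of_real (1 / (2 * T)) * integral {-T..T} e) \<le> 1 / (\<bar>\<theta>\<bar> * T)" if "T > 0" for T
  proof -
    have "norm (e T - e (-T)) \<le> 2"
      using norm_triangle_ineq4[of "e T" "e (-T)"] by (simp add: e)
    then show ?thesis
      using that False by (simp add: int norm_mult norm_divide divide_simps)
  qed
  then have "eventually (\<lambda>T. norm (complex_of_real (1 / (2 * T)) * integral {-T..T} e) \<le> 1 / (\<bar>\<theta>\<bar> * T)) at_top"
    using eventually_gt_at_top[of 0] by (rule eventually_mono[rotated])
  moreover have "((\<lambda>T. 1 / (\<bar>\<theta>\<bar> * T)) \<longlongrightarrow> 0) at_top"
    using False
    by (intro tendsto_divide_0[OF tendsto_const] filterlim_at_top_imp_at_infinity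
        filterlim_tendsto_pos_mult_at_top[OF tendsto_const]) (auto intro: filterlim_ident)
  ultimately have "((\<lambda>T. complex_of_real (1 / (2 * T)) * integral {-T..T} e) \<longlongrightarrow> 0) at_top"
    by (rule Lim_null_comparison)
  then show ?thesis
    using False by (simp add: has_mean_def e_def)
qed

inductive trig_poly :: "(real \<Rightarrow> complex) \<Rightarrow> bool" where
  exp: "trig_poly (\<lambda>t. c * exp (\<i> * of_real (\<theta> * t)))"
| add: "trig_poly f \<Longrightarrow> trig_poly g \<Longrightarrow> trig_poly (\<lambda>t. f t + g t)"

lemma trig_poly_const: "trig_poly (\<lambda>t. c)"
  using trig_poly.exp[of c 0] by simp

lemma trig_poly_mult_exp:
  assumes "trig_poly f"
  shows "trig_poly (\<lambda>t. f t * (c * exp (\<i> * of_real (\<theta> * t))))"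
  using assms
proof induction
  case (exp d \<eta>)
  have "(\<lambda>t. d * exp (\<i> * of_real (\<eta> * t)) * (c * exp (\<i> * of_real (\<theta> * t)))) =
        (\<lambda>t. (d * c) * exp (\<i> * of_real ((\<eta> + \<theta>) * t)))"
    by (simp add: fun_eq_iff distrib_left distrib_right exp_add)
  then show ?case
    by (simp only: trig_poly.exp)
qed (simp add: distrib_right trig_poly.add)

lemma trig_poly_mult:
  assumes "trig_poly f" "trig_poly g"
  shows "trig_poly (\<lambda>t. f t * g t)"
  using assms(2)
proof induction
  case (exp c \<theta>)
  then show ?case by (rule trig_poly_mult_exp[OF assms(1)])
qed (simp add: distrib_left trig_poly.add)

lemma trig_poly_sum:
  assumes "\<And>i. i \<in> I \<Longrightarrow> trig_poly (f i)"
  shows "trig_poly (\<lambda>t. \<Sum>i\<in>I. f i t)"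
  using assms
  by (induction I rule: infinite_finite_induct) (auto intro: trig_poly.add trig_poly_const)

lemma of_real_cos_eq_exp:
  "complex_of_real (cos x) = 1/2 * exp (\<i> * of_real x) + 1/2 * exp (\<i> * of_real (- x))"
proof -
  have "complex_of_real (cos x) = cos (of_real x)"
    by (simp add: cos_of_real)
  then show ?thesis
    by (simp add: cos_exp_eq add_divide_distrib)
qed

lemma trig_poly_cos: "trig_poly (\<lambda>t. complex_of_real (cos (w * t + d)))"
proof -
  have "complex_of_real (cos (w * t + d)) =
      exp (\<i> * of_real d) / 2 * exp (\<i> * of_real (w * t)) +
      exp (\<i> * of_real (- d)) / 2 * exp (\<i> * of_real (- w * t))" for t
  proof -
    have "exp (\<i> * of_real (w * t + d)) = exp (\<i> * of_real d) * exp (\<i> * of_real (w * t))"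
      unfolding exp_add[symmetric] by (simp add: algebra_simps)
    moreover have "exp (\<i> * of_real (- (w * t + d))) =
        exp (\<i> * of_real (- d)) * exp (\<i> * of_real (- w * t))"
      unfolding exp_add[symmetric] by (simp add: algebra_simps)
    ultimately show ?thesis
      unfolding of_real_cos_eq_exp by simp
  qed
  then show ?thesis
    by (simp only: trig_poly.intros)
qed

lemma trig_poly_continuous: "trig_poly f \<Longrightarrow> continuous_on UNIV f"
  by (induction rule: trig_poly.induct) (auto intro!: continuous_intros)

lemma trig_poly_has_mean: "trig_poly f \<Longrightarrow> \<exists>L. has_mean f L"
proof (induction rule: trig_poly.induct)
  case (exp c \<theta>)
  then show ?case using has_mean_cmult[OF has_mean_exp] by blast
next
  case (add f g)
  then obtain L M where "has_mean f L" "has_mean g M"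
    by blast
  then have "has_mean (\<lambda>t. f t + g t) (L + M)"
    by (rule has_mean_add[OF add.hyps[THEN trig_poly_continuous]])
  then show ?case ..
qed

text \<open>Bohr almost periodicity in the form of uniform approximability by trigonometric polynomials,
  which is what makes mean values exist.\<close>

definition almost_periodic :: "(real \<Rightarrow> complex) \<Rightarrow> bool" where
  "almost_periodic f \<longleftrightarrow> continuous_on UNIV f \<and>
     (\<forall>e>0. \<exists>g. trig_poly g \<and> (\<forall>t. norm (f t - g t) \<le> e))"

lemma almost_periodic_mult_exp:
  assumes "almost_periodic f"
  shows "almost_periodic (\<lambda>t. f t * exp (\<i> * of_real (\<theta> * t)))"
  unfolding almost_periodic_def
proof (intro conjI allI impI)
  show "continuous_on UNIV (\<lambda>t. f t * exp (\<i> * of_real (\<theta> * t)))"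
    using assms by (auto simp: almost_periodic_def intro!: continuous_intros)
  fix e :: real assume "e > 0"
  then obtain g where g: "trig_poly g" "\<And>t. norm (f t - g t) \<le> e"
    using assms unfolding almost_periodic_def by blast
  have "norm (f t * exp (\<i> * of_real (\<theta> * t)) - g t * exp (\<i> * of_real (\<theta> * t))) \<le> e" for t
    using g(2)[of t] by (simp add: norm_mult flip: left_diff_distrib)
  moreover have "trig_poly (\<lambda>t. g t * exp (\<i> * of_real (\<theta> * t)))"
    using trig_poly_mult_exp[OF g(1), of 1 \<theta>] by simp
  ultimately show "\<exists>h. trig_poly h \<and> (\<forall>t. norm (f t * exp (\<i> * of_real (\<theta> * t)) - h t) \<le> e)"
    by blast
qed

text \<open>A mean over \<open>[-T, T]\<close> changes by at most the uniform distance when the function is replaced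
  by a trigonometric polynomial, whose means converge. So the means form a Cauchy net as
  \<open>T \<rightarrow> \<infinity>\<close>.\<close>

lemma almost_periodic_has_mean:
  assumes "almost_periodic f"
  shows "\<exists>L. has_mean f L"
proof -
  define av where "av f T = complex_of_real (1 / (2 * T)) * integral {-T..T} f" for f T
  have "cauchy_filter (filtermap (av f) at_top)"
    unfolding cauchy_filter_metric_filtermap
  proof (intro allI impI)
    fix e :: real assume e: "e > 0"
    then obtain g where g: "trig_poly g" "\<And>t. norm (f t - g t) \<le> e / 4"
      using assms unfolding almost_periodic_def by (metis zero_less_divide_iff zero_less_numeral)
    note cont = trig_poly_continuous[OF g(1)]
    have contf: "continuous_on UNIV f"
      using assms by (simp add: almost_periodic_def)
    obtain L where "has_mean g L"
      using trig_poly_has_mean g(1) by blast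
    then have "eventually (\<lambda>T. dist (av g T) L < e / 4) at_top"
      unfolding has_mean_def av_def by (rule tendstoD) (use e in simp)
    moreover have "norm (av f T - av g T) \<le> e / 4" if "T > 0" for T
      using mean_norm_le[of "\<lambda>t. f t - g t" "e / 4" T] cont contf g(2) that
      by (simp add: av_def integral_diff continuous_integrable_interval right_diff_distrib
          continuous_on_diff)
    then have "eventually (\<lambda>T. norm (av f T - av g T) \<le> e / 4) at_top"
      using eventually_gt_at_top by (rule eventually_mono[rotated])
    ultimately have "eventually (\<lambda>T. dist (av f T) L < e / 2) at_top"
    proof eventually_elim
      case (elim T)
      then have "dist (av f T) (av g T) \<le> e / 4"
        by (simp add: dist_norm)
      with elim(1) show ?case
        using dist_triangle[of "av f T" L "av g T"] e by simp
    qed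
    then show "\<exists>P. eventually P at_top \<and> (\<forall>x y. P x \<and> P y \<longrightarrow> dist (av f x) (av f y) < e)"
    proof (intro exI conjI allI impI)
      fix x y assume "dist (av f x) L < e / 2 \<and> dist (av f y) L < e / 2"
      then show "dist (av f x) (av f y) < e"
        using dist_triangle_half_r[of L "av f x" e "av f y"] by (simp add: dist_commute)
    qed
  qed
  then have "convergent_filter (filtermap (av f) at_top)"
    by (rule cauchy_filter_convergent)
  then show ?thesis
    by (auto simp: convergent_filter_iff has_mean_def filterlim_def av_def[abs_def])
qed

section \<open>Fourier coefficients of almost periodic functions\<close>

lemma fourier_coeff_eqI:
  assumes "has_mean (\<lambda>t. of_real (q t) * exp (- (\<i> * of_real (a * t)))) L"
  shows "fourier_coeff q a = L"
  using assms unfolding fourier_coeff_def has_mean_def by (intro tendsto_Lim) auto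

text \<open>\<open>fourier_coeff\<close> is a limit picked by a choice operator; only its existence, proved here for
  almost periodic functions, makes the coefficient linear in the function and lets estimates
  pass to the limit.\<close>

lemma has_mean_fourier_coeff:
  assumes "almost_periodic (\<lambda>t. of_real (q t))"
  shows "has_mean (\<lambda>t. of_real (q t) * exp (- (\<i> * of_real (a * t)))) (fourier_coeff q a)"
proof -
  obtain L where "has_mean (\<lambda>t. of_real (q t) * exp (- (\<i> * of_real (a * t)))) L"
    using almost_periodic_has_mean[OF almost_periodic_mult_exp[OF assms, of "-a"]] by auto
  then show ?thesis
    using fourier_coeff_eqI by blast
qed

lemma almost_periodic_imp_continuous:
  "almost_periodic (\<lambda>t. complex_of_real (q t)) \<Longrightarrow> continuous_on UNIV q"
  using continuous_on_Re[of UNIV "\<lambda>t. complex_of_real (q t)"] by (simp add: almost_periodic_def)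

lemma fourier_coeff_add_cmult:
  assumes "almost_periodic (\<lambda>t. of_real (p t))" "almost_periodic (\<lambda>t. of_real (q t))"
  shows "fourier_coeff (\<lambda>t. p t + c * q t) a = fourier_coeff p a + of_real c * fourier_coeff q a"
proof (rule fourier_coeff_eqI)
  note [continuous_intros] = assms[THEN almost_periodic_imp_continuous]
  have "has_mean (\<lambda>t. of_real (p t) * exp (- (\<i> * of_real (a * t))) +
      of_real c * (of_real (q t) * exp (- (\<i> * of_real (a * t)))))
    (fourier_coeff p a + of_real c * fourier_coeff q a)"
    by (intro has_mean_add has_mean_cmult has_mean_fourier_coeff assms continuous_intros)
  then show "has_mean (\<lambda>t. of_real (p t + c * q t) * exp (- (\<i> * of_real (a * t))))
    (fourier_coeff p a + of_real c * fourier_coeff q a)"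
    by (simp add: algebra_simps)
qed

lemma norm_fourier_coeff_le:
  assumes "almost_periodic (\<lambda>t. of_real (q t))" "\<And>t. \<bar>q t\<bar> \<le> M"
  shows "norm (fourier_coeff q a) \<le> M"
proof (rule has_mean_norm_le[OF _ _ has_mean_fourier_coeff[OF assms(1)]])
  have "continuous_on UNIV q"
    using assms(1) by (rule almost_periodic_imp_continuous)
  then show "continuous_on UNIV (\<lambda>t. of_real (q t) * exp (- (\<i> * of_real (a * t))))"
    by (intro continuous_intros)
  show "norm (of_real (q t) * exp (- (\<i> * of_real (a * t)))) \<le> M" for t
    using assms(2)[of t] by (simp add: norm_mult)
qed

text \<open>Integration by parts over \<open>[-T, T]\<close>: the boundary term stays bounded and so vanishes after
  division by \<open>2 T\<close>, and what remains is that \<open>\<i> a\<close> times the coefficient of \<open>q\<close> is the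
  coefficient of \<open>q'\<close>.\<close>

lemma fourier_coeff_decay:
  assumes ap: "almost_periodic (\<lambda>t. of_real (q t))"
    and deriv: "\<And>t. (q has_real_derivative q' t) (at t)"
    and cont: "continuous_on UNIV q'"
    and bd: "\<And>t. \<bar>q t\<bar> \<le> M" and bd': "\<And>t. \<bar>q' t\<bar> \<le> M'"
  shows "\<bar>a\<bar> * norm (fourier_coeff q a) \<le> M'"
proof -
  define e where "e t = exp (- (\<i> * of_real (a * t)))" for t
  define av where "av f T = complex_of_real (1 / (2 * T)) * integral {-T..T} f" for f T
  define Q where "Q t = of_real (q t) * e t" for t
  define Q' where "Q' t = of_real (q' t) * e t" for t
  have norm_e: "norm (e t) = 1" for t by (simp add: e_def)
  have contQ: "continuous_on UNIV Q" "continuous_on UNIV Q'"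
    using almost_periodic_imp_continuous[OF ap] cont
    unfolding Q_def Q'_def e_def by (auto intro!: continuous_intros)
  have "(Q has_vector_derivative (Q' t - \<i> * of_real a * Q t)) (at t within S)" for t S
  proof -
    have 1: "((\<lambda>t. complex_of_real (q t)) has_vector_derivative of_real (q' t)) (at t within S)"
      using deriv[of t] by (intro has_vector_derivative_of_real)
        (simp add: has_real_derivative_iff_has_vector_derivative has_vector_derivative_at_within)
    have 2: "(e has_vector_derivative (- (\<i> * of_real a) * e t)) (at t within S)"
      unfolding e_def
      by (auto intro!: derivative_eq_intros has_vector_derivative_real_field)
    show ?thesis
      using has_vector_derivative_mult[OF 1 2] unfolding Q_def Q'_def
      by (simp add: algebra_simps)
  qed
  then have ftc: "((\<lambda>t. Q' t - \<i> * of_real a * Q t) has_integral (Q T - Q (-T))) {-T..T}"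
    if "T > 0" for T
    using that by (intro fundamental_theorem_of_calculus) auto
  then have parts: "integral {-T..T} Q' - \<i> * of_real a * integral {-T..T} Q = Q T - Q (-T)"
    if "T > 0" for T
  proof -
    have "integral {-T..T} (\<lambda>t. Q' t - \<i> * of_real a * Q t) = Q T - Q (-T)"
      using ftc[OF that] by (rule integral_unique)
    then show ?thesis
      by (simp add: integral_diff integrable_on_mult_right continuous_integrable_interval contQ)
  qed
  have bound: "norm (\<i> * of_real a * av Q T) \<le> M' + M / T" if "T > 0" for T
  proof -
    have "\<i> * of_real a * av Q T = av Q' T - of_real (1 / (2 * T)) * (Q T - Q (-T))"
      unfolding av_def parts[OF that, symmetric] right_diff_distrib by simp
    also have "norm \<dots> \<le> norm (av Q' T) + norm (of_real (1 / (2 * T)) * (Q T - Q (-T)))"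
      by (rule norm_triangle_ineq4)
    also have "norm (av Q' T) \<le> M'"
      unfolding av_def using contQ bd' that
      by (intro mean_norm_le) (auto simp: Q'_def norm_mult norm_e)
    also have "norm (Q T - Q (-T)) \<le> 2 * M"
      using norm_triangle_ineq4[of "Q T" "Q (-T)"] bd[of T] bd[of "-T"]
      by (simp add: Q_def norm_mult norm_e)
    then have "norm (of_real (1 / (2 * T)) * (Q T - Q (-T))) \<le> M / T"
      using that by (simp add: norm_mult norm_divide field_simps)
    finally show ?thesis by simp
  qed
  have "((\<lambda>T. norm (\<i> * of_real a * av Q T)) \<longlongrightarrow> norm (\<i> * of_real a * fourier_coeff q a)) at_top"
    using has_mean_fourier_coeff[OF ap, of a]
    by (intro tendsto_intros) (simp add: has_mean_def av_def Q_def[abs_def] e_def)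
  moreover have "((\<lambda>T. M' + M / T) \<longlongrightarrow> M' + 0) at_top"
    by (intro tendsto_intros tendsto_divide_0[OF tendsto_const] filterlim_at_top_imp_at_infinity filterlim_ident)
  moreover have "eventually (\<lambda>T. norm (\<i> * of_real a * av Q T) \<le> M' + M / T) at_top"
    using eventually_gt_at_top[of 0] by eventually_elim (rule bound)
  ultimately have "norm (\<i> * of_real a * fourier_coeff q a) \<le> M' + 0"
    by (intro tendsto_le) auto
  then show ?thesis
    by (simp add: norm_mult)
qed

lemma fourier_coeff_cos:
  assumes "w \<noteq> 0"
  shows "fourier_coeff (\<lambda>t. cos (w * t)) a = (if \<bar>a\<bar> = \<bar>w\<bar> then 1/2 else 0)"
proof (rule fourier_coeff_eqI)
  let ?e = "\<lambda>\<theta> t. exp (\<i> * of_real (\<theta> * t))"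
  have "of_real (cos (w * t)) * exp (- (\<i> * of_real (a * t))) =
      1/2 * ?e (w - a) t + 1/2 * ?e (- w - a) t" for t
  proof -
    have "?e (w - a) t = exp (\<i> * of_real (w * t)) * exp (- (\<i> * of_real (a * t)))"
      unfolding exp_add[symmetric] by (simp add: algebra_simps)
    moreover have "?e (- w - a) t = exp (\<i> * of_real (- (w * t))) * exp (- (\<i> * of_real (a * t)))"
      unfolding exp_add[symmetric] by (rule arg_cong[where f = exp]) (simp add: algebra_simps)
    ultimately show ?thesis
      unfolding of_real_cos_eq_exp by (simp only: distrib_right mult.assoc)
  qed
  moreover have "has_mean (\<lambda>t. 1/2 * ?e (w - a) t + 1/2 * ?e (- w - a) t)
    (1/2 * (if w - a = 0 then 1 else 0) + 1/2 * (if - w - a = 0 then 1 else 0))"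
    by (intro has_mean_add has_mean_cmult has_mean_exp continuous_intros)
  moreover have "1/2 * (if w - a = 0 then 1 else 0) + 1/2 * (if - w - a = 0 then 1 else 0) =
    (if \<bar>a\<bar> = \<bar>w\<bar> then 1/2 else (0::complex))"
    using assms by (auto simp: abs_if)
  ultimately show "has_mean (\<lambda>t. of_real (cos (w * t)) * exp (- (\<i> * of_real (a * t))))
    (if \<bar>a\<bar> = \<bar>w\<bar> then 1/2 else 0)"
    by simp
qed

section \<open>Continuous functions on the torus along a line\<close>

definition periodic :: "(real^'n \<Rightarrow> 'b) \<Rightarrow> bool" where
  "periodic f \<longleftrightarrow> (\<forall>x z. integer_vec z \<longrightarrow> f (x + z) = f x)"

lemma periodic_eq: "periodic f \<Longrightarrow> integer_vec (x - y) \<Longrightarrow> f x = f y"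
  by (metis periodic_def add.commute diff_add_cancel)

lemma periodic_to_torus:
  fixes p :: "'n::finite torus \<Rightarrow> 'b"
  shows "periodic (\<lambda>x. p (to_torus x))"
proof -
  have "to_torus (x + z) = to_torus x" if "integer_vec z" for x z :: "real^'n"
    using that by (simp add: to_torus_eq_iff)
  then show ?thesis
    by (simp add: periodic_def)
qed

lemma unit_cube_representative:
  fixes x :: "real^'n"
  obtains y where "y \<in> cbox 0 1" "integer_vec (x - y)"
proof
  show "(\<chi> i. frac (x $ i)) \<in> cbox 0 1"
    by (auto simp: mem_box_cart less_imp_le frac_lt_1)
  show "integer_vec (x - (\<chi> i. frac (x $ i)))"
    by (simp add: integer_vec_def frac_def)
qed

lemma continuous_periodic_bounded:
  fixes f :: "real^'n \<Rightarrow> real"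
  assumes "continuous_on UNIV f" "periodic f"
  obtains M where "\<And>x. \<bar>f x\<bar> \<le> M"
proof -
  have "bounded (f ` cbox 0 1)"
    by (intro compact_imp_bounded compact_continuous_image continuous_on_subset[OF assms(1)]) auto
  then obtain M where M: "\<And>x. x \<in> cbox 0 1 \<Longrightarrow> \<bar>f x\<bar> \<le> M"
    by (auto simp: bounded_iff)
  have "\<bar>f x\<bar> \<le> M" for x
  proof -
    obtain y where "y \<in> cbox 0 1" "integer_vec (x - y)"
      by (rule unit_cube_representative)
    then show ?thesis
      using periodic_eq[OF assms(2)] M by metis
  qed
  then show thesis by (rule that)
qed

text \<open>The torus as a compact subset of a Euclidean space, so that the theorem of Stone and Weierstrass
  for polynomials in the ambient coordinates applies to periodic functions.\<close>

definition torus_embed :: "real^'n \<Rightarrow> (real^'n) \<times> (real^'n)" where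
  "torus_embed x = (\<chi> i. cos (2 * pi * x $ i), \<chi> i. sin (2 * pi * x $ i))"

lemma continuous_torus_embed: "continuous_on S torus_embed"
  unfolding torus_embed_def
  by (intro continuous_on_Pair continuous_on_vec_lambda) (auto intro!: continuous_intros)

lemma torus_embed_eq_iff: "torus_embed x = torus_embed y \<longleftrightarrow> integer_vec (x - y)"
proof -
  have "(cos (2 * pi * a) = cos (2 * pi * b) \<and> sin (2 * pi * a) = sin (2 * pi * b)) \<longleftrightarrow> a - b \<in> \<int>"
    for a b :: real
  proof -
    have "2 * pi * a = 2 * pi * b + 2 * pi * n \<longleftrightarrow> a - b = n" for n
    proof -
      have "2 * pi * b + 2 * pi * n = 2 * pi * (b + n)"
        by (simp add: distrib_left)
      then show ?thesis
        by auto
    qed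
    then show ?thesis
      using sin_cos_eq_iff[of "2 * pi * a" "2 * pi * b"] by (auto simp: Ints_def)
  qed
  then show ?thesis
    by (auto simp: torus_embed_def vec_eq_iff integer_vec_def)
qed

text \<open>The embedding restricted to the compact unit cube is a closed map onto the embedded torus, hence
  a quotient map; so the induced function is continuous.\<close>

lemma periodic_factors_through_embedding:
  fixes f :: "real^'n \<Rightarrow> real"
  assumes "continuous_on UNIV f" "periodic f"
  obtains F where "continuous_on (range torus_embed) F" "\<And>x. F (torus_embed x) = f x"
    "compact (range (torus_embed :: real^'n \<Rightarrow> _))"
proof -
  let ?E = "torus_embed :: real^'n \<Rightarrow> _"
  define F where "F u = f (SOME x. ?E x = u)" for u
  have F: "F (?E x) = f x" for x
    unfolding F_def
    by (rule periodic_eq[OF assms(2)]) (metis (mono_tags, lifting) someI torus_embed_eq_iff)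
  have cube: "\<exists>y \<in> cbox 0 1. ?E y = ?E x \<and> f y = f x" for x
  proof -
    obtain y where "y \<in> cbox 0 1" "integer_vec (x - y)"
      by (rule unit_cube_representative)
    then show ?thesis
      using torus_embed_eq_iff[of x y] periodic_eq[OF assms(2)] by metis
  qed
  then have "range ?E \<subseteq> ?E ` cbox 0 1"
    by (metis image_eqI image_subsetI)
  then have "range ?E = ?E ` cbox 0 1"
    by blast
  then have comp: "compact (range ?E)"
    by (simp add: compact_continuous_image continuous_torus_embed)
  have "closed (F -` C \<inter> range ?E)" if "closed C" for C
  proof -
    have "F -` C \<inter> range ?E = ?E ` (cbox 0 1 \<inter> f -` C)"
    proof (intro equalityI subsetI)
      fix u assume "u \<in> F -` C \<inter> range ?E"
      then obtain x where x: "u = ?E x" "f x \<in> C"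
        by (auto simp: F)
      obtain y where "y \<in> cbox 0 1" "?E y = ?E x" "f y = f x"
        using cube by blast
      then show "u \<in> ?E ` (cbox 0 1 \<inter> f -` C)"
        using x by (metis IntI image_eqI vimageI2)
    qed (auto simp: F)
    moreover have "closed (f -` C)"
      using assms(1) that by (simp add: continuous_on_closed_vimage[of UNIV f])
    then have "compact (?E ` (cbox 0 1 \<inter> f -` C))"
      by (simp add: compact_continuous_image continuous_torus_embed compact_Int_closed)
    ultimately show ?thesis
      by (simp add: compact_imp_closed)
  qed
  then have "continuous_on (range ?E) F"
    using comp by (simp add: continuous_on_closed_vimage compact_imp_closed)
  then show thesis
    using F comp by (rule that[of F])
qed

text \<open>Along a line each ambient coordinate is \<open>cos (\<alpha> t + \<beta>)\<close>, and trigonometric polynomials form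
  an algebra.\<close>

lemma trig_poly_polynomial_on_line:
  fixes g :: "(real^'n) \<times> (real^'n) \<Rightarrow> real"
  assumes "real_polynomial_function g"
  shows "trig_poly (\<lambda>t. of_real (g (torus_embed (t *\<^sub>R w + s))))"
  using assms
proof induction
  case (linear f)
  interpret bounded_linear f by fact
  have coord: "trig_poly (\<lambda>t. of_real (torus_embed (t *\<^sub>R w + s) \<bullet> b))"
    if "b \<in> Basis" for b :: "(real^'n) \<times> (real^'n)"
  proof -
    have cos: "trig_poly (\<lambda>t. of_real (cos (2 * pi * (t *\<^sub>R w + s) $ i)))" for i
      using trig_poly_cos[of "2 * pi * w $ i" "2 * pi * s $ i"] by (simp add: algebra_simps)
    have sin: "trig_poly (\<lambda>t. of_real (sin (2 * pi * (t *\<^sub>R w + s) $ i)))" for i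
      using trig_poly_cos[of "- 2 * pi * w $ i" "pi / 2 - 2 * pi * s $ i"]
      by (simp add: sin_cos_eq algebra_simps)
    from that show ?thesis
      by (auto simp: Basis_prod_def Basis_vec_def torus_embed_def inner_axis
          intro: cos[simplified] sin[simplified])
  qed
  have expand: "f x = (\<Sum>b\<in>Basis. (x \<bullet> b) * f b)" for x
  proof -
    have "f (\<Sum>b\<in>Basis. (x \<bullet> b) *\<^sub>R b) = (\<Sum>b\<in>Basis. (x \<bullet> b) * f b)"
      by (simp only: sum scaleR real_scaleR_def)
    then show ?thesis
      by (simp only: euclidean_representation)
  qed
  have "trig_poly (\<lambda>t. \<Sum>b\<in>Basis. of_real (torus_embed (t *\<^sub>R w + s) \<bullet> b) * of_real (f b))"
    by (intro trig_poly_sum trig_poly_mult coord trig_poly_const)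
  then show ?case
    by (subst expand) simp
qed (auto intro: trig_poly_const trig_poly.add trig_poly_mult)

lemma almost_periodic_on_line:
  fixes f :: "real^'n \<Rightarrow> real"
  assumes "continuous_on UNIV f" "periodic f"
  shows "almost_periodic (\<lambda>t. of_real (f (t *\<^sub>R w + s)))"
  unfolding almost_periodic_def
proof (intro conjI allI impI)
  show "continuous_on UNIV (\<lambda>t. complex_of_real (f (t *\<^sub>R w + s)))"
    by (intro continuous_intros continuous_on_compose2[OF assms(1)]) auto
  fix e :: real assume "e > 0"
  obtain F where F: "continuous_on (range torus_embed) F" "\<And>x. F (torus_embed x) = f x"
    "compact (range (torus_embed :: real^'n \<Rightarrow> _))"
    using periodic_factors_through_embedding[OF assms] by blast
  obtain g where g: "real_polynomial_function g"
    and approx: "\<And>u. u \<in> range torus_embed \<Longrightarrow> \<bar>F u - g u\<bar> < e"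
    using Stone_Weierstrass_real_polynomial_function[OF F(3,1) \<open>e > 0\<close>] by blast
  have "\<bar>f x - g (torus_embed x)\<bar> \<le> e" for x
    using approx[of "torus_embed x"] by (simp add: F(2))
  then show "\<exists>h. trig_poly h \<and> (\<forall>t. norm (complex_of_real (f (t *\<^sub>R w + s)) - h t) \<le> e)"
    using trig_poly_polynomial_on_line[OF g, of w s]
    by (intro exI[of _ "\<lambda>t. complex_of_real (g (torus_embed (t *\<^sub>R w + s)))"])
       (simp flip: of_real_diff)
qed

section \<open>Differentiable functions on the torus\<close>

lemma iter_partial_Nil [simp]: "iter_partial [] f = f"
  by (simp add: iter_partial_def)

lemma iter_partial_Cons [simp]: "iter_partial (i # is) f = partial_deriv i (iter_partial is f)"
  by (simp add: iter_partial_def)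

lemma C_diffD:
  assumes "C_diff m f"
  shows "length is < m \<Longrightarrow> iter_partial is f differentiable (at x)"
    and "length is \<le> m \<Longrightarrow> continuous_on UNIV (iter_partial is f)"
  using assms by (auto simp: C_diff_def)

lemma partial_deriv_eq: "(f has_derivative f') (at x) \<Longrightarrow> partial_deriv i f x = f' (axis i 1)"
  by (metis partial_deriv_def frechet_derivative_at)

lemma iter_partial_add_cmult:
  fixes f g :: "real^'n \<Rightarrow> real"
  assumes "C_diff m f" "C_diff m g" "length is \<le> m"
  shows "iter_partial is (\<lambda>x. f x + c * g x) = (\<lambda>x. iter_partial is f x + c * iter_partial is g x)"
  using assms(3)
proof (induction "is")
  case (Cons i "is")
  have "partial_deriv i (\<lambda>x. iter_partial is f x + c * iter_partial is g x) x =
      partial_deriv i (iter_partial is f) x + c * partial_deriv i (iter_partial is g) x" for x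
  proof -
    have "iter_partial is f differentiable (at x)" "iter_partial is g differentiable (at x)"
      using C_diffD(1)[OF assms(1)] C_diffD(1)[OF assms(2)] Cons.prems by auto
    then have d: "(iter_partial is f has_derivative frechet_derivative (iter_partial is f) (at x)) (at x)"
      "(iter_partial is g has_derivative frechet_derivative (iter_partial is g) (at x)) (at x)"
      by (simp_all add: frechet_derivative_works)
    show ?thesis
      using partial_deriv_eq[OF has_derivative_add[OF d(1) has_derivative_mult_right[OF d(2), of c]]]
      by (simp add: partial_deriv_def)
  qed
  with Cons show ?case by simp
qed simp

lemma C_diff_add_cmult:
  fixes f g :: "real^'n \<Rightarrow> real"
  assumes "C_diff m f" "C_diff m g"
  shows "C_diff m (\<lambda>x. f x + c * g x)"
  unfolding C_diff_def
proof (intro conjI allI impI)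
  fix "is" :: "'n list" and x
  assume "length is < m"
  then show "iter_partial is (\<lambda>x. f x + c * g x) differentiable at x"
    using C_diffD(1)[OF assms(1)] C_diffD(1)[OF assms(2)]
    by (simp add: iter_partial_add_cmult[OF assms] differentiable_add differentiable_mult)
next
  fix "is" :: "'n list"
  assume "length is \<le> m"
  then show "continuous_on UNIV (iter_partial is (\<lambda>x. f x + c * g x))"
    using C_diffD(2)[OF assms(1)] C_diffD(2)[OF assms(2)]
    by (simp add: iter_partial_add_cmult[OF assms] continuous_on_add continuous_on_mult_left)
qed

lemma C_torus_add_cmult:
  "p \<in> C_torus m \<Longrightarrow> q \<in> C_torus m \<Longrightarrow> (\<lambda>x. p x + c * q x) \<in> C_torus m"
  by (simp add: C_torus_def C_diff_add_cmult)

lemma C_diff_continuous: "C_diff m f \<Longrightarrow> continuous_on UNIV f"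
  using C_diffD(2)[of m f "[]"] by simp

lemma C_diff_Suc_continuous_partial:
  assumes "C_diff (Suc m) f"
  shows "continuous_on UNIV (partial_deriv i f)"
  using C_diffD(2)[OF assms, of "[i]"] by simp

lemma C_diff_Suc_has_derivative:
  assumes "C_diff (Suc m) f"
  shows "(f has_derivative (\<lambda>h. \<Sum>i\<in>UNIV. h $ i * partial_deriv i f x)) (at x)"
proof -
  have "f differentiable (at x)"
    using C_diffD(1)[OF assms, of "[]"] by simp
  then have D: "(f has_derivative frechet_derivative f (at x)) (at x)"
    by (simp add: frechet_derivative_works)
  then interpret bounded_linear "frechet_derivative f (at x)"
    by (rule has_derivative_bounded_linear)
  have "frechet_derivative f (at x) h = (\<Sum>i\<in>UNIV. h $ i * partial_deriv i f x)" for h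
  proof -
    have "h = (\<Sum>i\<in>UNIV. h $ i *\<^sub>R axis i 1)"
      by (simp add: basis_expansion scalar_mult_eq_scaleR[symmetric])
    then have "frechet_derivative f (at x) h = frechet_derivative f (at x) (\<Sum>i\<in>UNIV. h $ i *\<^sub>R axis i 1)"
      by simp
    then show ?thesis
      by (simp add: sum scaleR partial_deriv_def)
  qed
  then have "frechet_derivative f (at x) = (\<lambda>h. \<Sum>i\<in>UNIV. h $ i * partial_deriv i f x)"
    by (rule ext)
  with D show ?thesis by simp
qed

text \<open>Periodicity makes the continuous partial derivatives bounded, although they live on the
  noncompact space.\<close>

lemma periodic_partial_deriv:
  fixes f :: "real^'n \<Rightarrow> real"
  assumes "C_diff (Suc m) f" "periodic f"
  shows "periodic (partial_deriv i f)"
  unfolding periodic_def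
proof (intro allI impI)
  fix x z :: "real^'n" assume z: "integer_vec z"
  have "((\<lambda>y. f (y + z)) has_derivative (\<lambda>h. \<Sum>i\<in>UNIV. h $ i * partial_deriv i f (x + z))) (at x)"
    using C_diff_Suc_has_derivative[OF assms(1), of "x + z"]
    by (rule has_derivative_compose[rotated]) (auto intro!: derivative_eq_intros)
  moreover have "(\<lambda>y. f (y + z)) = f"
    using assms(2) z by (simp add: periodic_def)
  ultimately have "partial_deriv i f x = (\<Sum>j\<in>UNIV. axis i 1 $ j * partial_deriv j f (x + z))"
    using partial_deriv_eq by fastforce
  then show "partial_deriv i f (x + z) = partial_deriv i f x"
    by (simp add: axis_def if_distrib[of "\<lambda>a. a * _"] cong: if_cong)
qed

lemma C_diff_Suc_line_derivative:
  fixes f :: "real^'n \<Rightarrow> real"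
  assumes "C_diff (Suc m) f"
  shows "((\<lambda>t. f (t *\<^sub>R w + s)) has_real_derivative
      (\<Sum>i\<in>UNIV. w $ i * partial_deriv i f (t *\<^sub>R w + s))) (at t)"
proof -
  have "((\<lambda>t. t *\<^sub>R w + s) has_derivative (\<lambda>h. h *\<^sub>R w)) (at t)"
    by (auto intro!: derivative_eq_intros)
  from has_derivative_compose[OF this C_diff_Suc_has_derivative[OF assms]]
  have "((\<lambda>t. f (t *\<^sub>R w + s)) has_derivative
      (\<lambda>h. \<Sum>i\<in>UNIV. (h *\<^sub>R w) $ i * partial_deriv i f (t *\<^sub>R w + s))) (at t)" .
  moreover have "(\<lambda>h. \<Sum>i\<in>UNIV. (h *\<^sub>R w) $ i * partial_deriv i f (t *\<^sub>R w + s)) =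
      (*) (\<Sum>i\<in>UNIV. w $ i * partial_deriv i f (t *\<^sub>R w + s))"
    by (rule ext) (simp add: sum_distrib_left mult_ac)
  ultimately show ?thesis
    by (simp add: has_field_derivative_def)
qed

section \<open>Trigonometric test functions\<close>

text \<open>Differentiation only shifts the phase by a quarter period and multiplies by a coordinate of the
  wave vector, so that all derivatives up to a given order are bounded together.\<close>

lemma iter_partial_cos:
  fixes u :: "real^'n"
  shows "\<exists>c e. iter_partial is (\<lambda>x. cos (u \<bullet> x + d)) = (\<lambda>x. c * cos (u \<bullet> x + e)) \<and>
    \<bar>c\<bar> \<le> (1 + norm u) ^ length is"
proof (induction "is")
  case Nil
  show ?case by (intro exI[of _ 1] exI[of _ d]) simp
next
  case (Cons i "is")
  then obtain c e where IH: "iter_partial is (\<lambda>x. cos (u \<bullet> x + d)) = (\<lambda>x. c * cos (u \<bullet> x + e))"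
    "\<bar>c\<bar> \<le> (1 + norm u) ^ length is" by blast
  have "partial_deriv i (\<lambda>x. c * cos (u \<bullet> x + e)) x = (c * u $ i) * cos (u \<bullet> x + (e + pi / 2))" for x
  proof -
    have "((\<lambda>x. c * cos (u \<bullet> x + e)) has_derivative (\<lambda>h. c * (- sin (u \<bullet> x + e) * (u \<bullet> h)))) (at x)"
      by (auto intro!: derivative_eq_intros)
    from partial_deriv_eq[OF this] show ?thesis
      using minus_sin_cos_eq[of "u \<bullet> x + e"] by (simp add: inner_axis add.assoc)
  qed
  moreover have "\<bar>c * u $ i\<bar> \<le> (1 + norm u) ^ length (i # is)"
    using mult_mono[OF IH(2), of "\<bar>u $ i\<bar>" "1 + norm u"] component_le_norm_cart[of u i]
    by (simp add: abs_mult mult.commute)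
  ultimately show ?case
    using IH(1) by (metis (no_types, lifting) ext iter_partial_Cons)
qed

lemma C_diff_cos: "C_diff m (\<lambda>x. cos (u \<bullet> x + d))"
proof -
  have "iter_partial is (\<lambda>x. cos (u \<bullet> x + d)) differentiable (at x)"
    "continuous_on UNIV (iter_partial is (\<lambda>x. cos (u \<bullet> x + d)))" for "is" and x
  proof -
    obtain c e where c: "iter_partial is (\<lambda>x. cos (u \<bullet> x + d)) = (\<lambda>x. c * cos (u \<bullet> x + e))"
      using iter_partial_cos by blast
    have "((\<lambda>x. c * cos (u \<bullet> x + e)) has_derivative (\<lambda>h. c * (- sin (u \<bullet> x + e) * (u \<bullet> h)))) (at x)"
      by (auto intro!: derivative_eq_intros)
    then show "iter_partial is (\<lambda>x. cos (u \<bullet> x + d)) differentiable (at x)"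
      unfolding c differentiable_def by blast
    show "continuous_on UNIV (iter_partial is (\<lambda>x. cos (u \<bullet> x + d)))"
      unfolding c by (intro continuous_intros)
  qed
  then show ?thesis by (simp add: C_diff_def)
qed

text \<open>The test functions for nonvanishing: real parts of the characters of lowest frequency, one for
  each coordinate direction.\<close>

lift_definition coordinate_wave :: "'n \<Rightarrow> 'n::finite torus \<Rightarrow> real"
  is "\<lambda>i x. cos (2 * pi * x $ i)"
  using torus_embed_eq_iff by (fastforce simp: torus_rel_def torus_embed_def vec_eq_iff)

lemma coordinate_wave_to_torus: "coordinate_wave i (to_torus x) = cos (2 * pi * x $ i)"
  by transfer simp

lemma shifted_wave_lift:
  fixes s :: "real^'n"
  shows "coordinate_wave i (to_torus x - to_torus s) = cos ((2 * pi) *\<^sub>R axis i 1 \<bullet> x + - 2 * pi * s $ i)"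
proof -
  have "to_torus x - to_torus s = to_torus (x - s)"
    using to_torus_add[of "x - s" s] by (simp add: diff_eq_eq)
  then show ?thesis
    by (simp add: coordinate_wave_to_torus inner_axis' algebra_simps)
qed

lemma shifted_wave_C_torus: "(\<lambda>x. coordinate_wave i (x - t0)) \<in> C_torus m"
proof -
  obtain s where "to_torus s = t0"
    using to_torus_surj by blast
  then have "(\<lambda>x. coordinate_wave i (to_torus x - t0)) =
      (\<lambda>x. cos ((2 * pi) *\<^sub>R axis i 1 \<bullet> x + - 2 * pi * s $ i))"
    using shifted_wave_lift by metis
  then show ?thesis
    using C_diff_cos by (simp only: C_torus_def mem_Collect_eq)
qed

lemma shifted_wave_derivatives_bounded:
  fixes t0 :: "'n::finite torus"
  obtains M where "M > 0"
    "\<And>is x. length is \<le> m \<Longrightarrow> \<bar>iter_partial is (\<lambda>x. coordinate_wave i (to_torus x - t0)) x\<bar> \<le> M"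
proof
  let ?u = "(2 * pi) *\<^sub>R axis i 1 :: real^'n"
  obtain s where "to_torus s = t0"
    using to_torus_surj by blast
  then have wave: "(\<lambda>x. coordinate_wave i (to_torus x - t0)) =
      (\<lambda>x. cos (?u \<bullet> x + - 2 * pi * s $ i))"
    using shifted_wave_lift by metis
  show "(1 + norm ?u) ^ m > 0"
    by (simp add: add_pos_nonneg)
  fix "is" :: "'n list" and x :: "real^'n" assume len: "length is \<le> m"
  obtain c e where c: "iter_partial is (\<lambda>x. cos (?u \<bullet> x + - 2 * pi * s $ i)) = (\<lambda>x. c * cos (?u \<bullet> x + e))"
    "\<bar>c\<bar> \<le> (1 + norm ?u) ^ length is"
    using iter_partial_cos by blast
  have "\<bar>c * cos (?u \<bullet> x + e)\<bar> \<le> \<bar>c\<bar>"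
    using mult_left_le[of "\<bar>cos (?u \<bullet> x + e)\<bar>" "\<bar>c\<bar>"] by (simp add: abs_mult)
  also have "\<dots> \<le> (1 + norm ?u) ^ m"
    by (rule order_trans[OF c(2)]) (rule power_increasing[OF len], simp)
  finally show "\<bar>iter_partial is (\<lambda>x. coordinate_wave i (to_torus x - t0)) x\<bar> \<le> (1 + norm ?u) ^ m"
    unfolding wave c(1) .
qed

lemma C_close_small_multiple:
  fixes p h :: "'n::finite torus \<Rightarrow> real"
  assumes "p \<in> C_torus m" "h \<in> C_torus m" "M > 0" "\<epsilon> > 0"
    and "\<And>is x. length is \<le> m \<Longrightarrow> \<bar>iter_partial is (\<lambda>x. h (to_torus x)) x\<bar> \<le> M"
  shows "C_close m \<epsilon> p (\<lambda>x. p x + (\<epsilon> / (2 * M)) * h x)"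
  unfolding C_close_def
proof (intro allI impI)
  fix "is" :: "'n list" and x :: "real^'n" assume len: "length is \<le> m"
  let ?c = "\<epsilon> / (2 * M)"
  have c: "?c \<ge> 0"
    using assms(3,4) by simp
  have "\<bar>?c * iter_partial is (\<lambda>x. h (to_torus x)) x\<bar> \<le> ?c * M"
    unfolding abs_mult abs_of_nonneg[OF c] by (rule mult_left_mono[OF assms(5)[OF len] c])
  also have "\<dots> < \<epsilon>"
    using assms(3,4) by simp
  finally have "\<bar>?c * iter_partial is (\<lambda>x. h (to_torus x)) x\<bar> < \<epsilon>" .
  moreover have eq: "iter_partial is (\<lambda>y. p (to_torus y) + ?c * h (to_torus y)) =
      (\<lambda>x. iter_partial is (\<lambda>y. p (to_torus y)) x + ?c * iter_partial is (\<lambda>y. h (to_torus y)) x)"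
    using assms(1,2) by (intro iter_partial_add_cmult[OF _ _ len]) (simp_all only: C_torus_def mem_Collect_eq)
  ultimately show "\<bar>iter_partial is (\<lambda>y. p (to_torus y)) x -
      iter_partial is (\<lambda>y. p (to_torus y) + ?c * h (to_torus y)) x\<bar> < \<epsilon>"
    unfolding eq by linarith
qed

section \<open>Fourier coefficients along a line through the torus\<close>

lemma line_restriction_lift:
  "line_restriction p (to_torus s) w = (\<lambda>t. p (to_torus (t *\<^sub>R w + s)))"
  by (simp add: line_restriction_def to_torus_add)

lemma almost_periodic_line_restriction:
  assumes "p \<in> C_torus m"
  shows "almost_periodic (\<lambda>t. of_real (line_restriction p t0 w t))"
proof -
  obtain s where s: "to_torus s = t0"
    using to_torus_surj by blast
  have "continuous_on UNIV (\<lambda>x. p (to_torus x))"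
    using assms C_diff_continuous by (auto simp: C_torus_def)
  from almost_periodic_on_line[OF this periodic_to_torus]
  show ?thesis
    by (simp add: line_restriction_lift flip: s)
qed

text \<open>The estimates for the series see a function only through its \<open>C\<^sup>1\<close> norm.\<close>

definition C1_bounded :: "('n::finite torus \<Rightarrow> real) \<Rightarrow> real \<Rightarrow> bool" where
  "C1_bounded p M \<longleftrightarrow> (\<forall>x. \<bar>p (to_torus x)\<bar> \<le> M) \<and>
     (\<forall>i x. \<bar>partial_deriv i (\<lambda>y. p (to_torus y)) x\<bar> \<le> M)"

lemma C_torus_Suc_C1_bounded:
  fixes p :: "'n::finite torus \<Rightarrow> real"
  assumes "p \<in> C_torus (Suc m)"
  obtains M where "C1_bounded p M"
proof -
  define P where "P = (\<lambda>x. p (to_torus x))"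
  have P: "C_diff (Suc m) P" "periodic P"
    using assms periodic_to_torus by (auto simp: P_def C_torus_def)
  obtain M0 where M0: "\<And>x. \<bar>P x\<bar> \<le> M0"
    using continuous_periodic_bounded[OF C_diff_continuous[OF P(1)] P(2)] by blast
  have "\<exists>M. \<forall>x. \<bar>partial_deriv i P x\<bar> \<le> M" for i
    using continuous_periodic_bounded[OF C_diff_Suc_continuous_partial[OF P(1)]
        periodic_partial_deriv[OF P]] by blast
  then obtain M where M: "\<And>i x. \<bar>partial_deriv i P x\<bar> \<le> M i"
    by metis
  have "\<bar>P x\<bar> \<le> max M0 (Max (range M))" for x
    using M0[of x] by simp
  moreover have "\<bar>partial_deriv i P x\<bar> \<le> max M0 (Max (range M))" for i x
    by (rule order_trans[OF M]) (simp add: le_max_iff_disj)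
  ultimately show thesis
    unfolding P_def by (intro that[of "max M0 (Max (range M))"]) (simp add: C1_bounded_def)
qed

lemma C_close_C1_bounded_diff:
  assumes "p \<in> C_torus (Suc m)" "q \<in> C_torus (Suc m)" "C_close (Suc m) \<epsilon> p q"
  shows "C1_bounded (\<lambda>x. q x + (-1) * p x) \<epsilon>"
proof -
  have "\<bar>iter_partial is (\<lambda>x. q (to_torus x) + (-1) * p (to_torus x)) x\<bar> \<le> \<epsilon>"
    if "length is \<le> Suc m" for "is" x
  proof -
    have "iter_partial is (\<lambda>x. q (to_torus x) + (-1) * p (to_torus x)) x =
        iter_partial is (\<lambda>x. q (to_torus x)) x + (-1) * iter_partial is (\<lambda>x. p (to_torus x)) x"
      using assms(1,2) by (subst iter_partial_add_cmult[OF _ _ that]) (simp_all add: C_torus_def)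
    then show ?thesis
      using assms(3) that by (simp add: C_close_def abs_minus_commute less_imp_le)
  qed
  from this[of "[]"] this[of "[i]" for i] show ?thesis
    by (simp add: C1_bounded_def)
qed

text \<open>The second bound is the first-order decay of the coefficients: along the line, the derivative in
  direction \<open>w\<close> is a combination of the partial derivatives with the coordinates of \<open>w\<close> as
  weights.\<close>

lemma fourier_coeff_line_bounds:
  fixes p :: "'n::finite torus \<Rightarrow> real"
  assumes "p \<in> C_torus (Suc m)" "C1_bounded p M"
  shows "norm (fourier_coeff (line_restriction p t0 w) a) \<le> M"
    and "\<bar>a\<bar> * norm (fourier_coeff (line_restriction p t0 w) a) \<le> M * (\<Sum>i\<in>UNIV. \<bar>w $ i\<bar>)"
proof -
  obtain s where s: "to_torus s = t0"
    using to_torus_surj by blast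
  let ?q = "line_restriction p t0 w"
  define P where "P = (\<lambda>x. p (to_torus x))"
  have q: "?q = (\<lambda>t. P (t *\<^sub>R w + s))"
    by (simp add: P_def line_restriction_lift flip: s)
  have P: "C_diff (Suc m) P"
    using assms(1) by (simp add: P_def C_torus_def)
  have bd: "\<And>x. \<bar>P x\<bar> \<le> M" "\<And>i x. \<bar>partial_deriv i P x\<bar> \<le> M"
    using assms(2) by (simp_all add: C1_bounded_def P_def)
  note ap = almost_periodic_line_restriction[OF assms(1), of t0 w]
  show "norm (fourier_coeff ?q a) \<le> M"
    by (rule norm_fourier_coeff_le[OF ap]) (simp add: q bd)
  show "\<bar>a\<bar> * norm (fourier_coeff ?q a) \<le> M * (\<Sum>i\<in>UNIV. \<bar>w $ i\<bar>)"
  proof (rule fourier_coeff_decay[OF ap])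
    show "(?q has_real_derivative (\<Sum>i\<in>UNIV. w $ i * partial_deriv i P (t *\<^sub>R w + s))) (at t)" for t
      unfolding q by (rule C_diff_Suc_line_derivative[OF P])
    show "continuous_on UNIV (\<lambda>t. \<Sum>i\<in>UNIV. w $ i * partial_deriv i P (t *\<^sub>R w + s))"
      by (intro continuous_intros continuous_on_compose2[OF C_diff_Suc_continuous_partial[OF P]]) auto
    show "\<bar>?q t\<bar> \<le> M" for t
      by (simp add: q bd)
    show "\<bar>\<Sum>i\<in>UNIV. w $ i * partial_deriv i P (t *\<^sub>R w + s)\<bar> \<le> M * (\<Sum>i\<in>UNIV. \<bar>w $ i\<bar>)" for t
    proof -
      have "\<bar>\<Sum>i\<in>UNIV. w $ i * partial_deriv i P (t *\<^sub>R w + s)\<bar> \<le>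
          (\<Sum>i\<in>UNIV. \<bar>w $ i * partial_deriv i P (t *\<^sub>R w + s)\<bar>)"
        by (rule sum_abs)
      also have "\<dots> \<le> (\<Sum>i\<in>UNIV. \<bar>w $ i\<bar> * M)"
        by (intro sum_mono) (simp add: abs_mult mult_left_mono bd)
      finally show ?thesis
        by (simp add: sum_distrib_left mult.commute)
    qed
  qed
qed

section \<open>The Fourier coefficients of the formal series\<close>

lemma summable_on_power_nat_abs:
  fixes r :: real
  assumes "0 \<le> r" "r < 1"
  shows "(\<lambda>n::int. r ^ nat \<bar>n\<bar>) summable_on UNIV"
proof -
  have geom: "(\<lambda>n::nat. r ^ n) summable_on UNIV"
    using assms by (simp add: summable_on_UNIV_nonneg_real_iff summable_geometric)
  have "(\<lambda>n::int. r ^ nat \<bar>n\<bar>) summable_on range int"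
    by (subst summable_on_reindex) (use geom in \<open>auto simp: o_def\<close>)
  moreover have "(\<lambda>n::int. r ^ nat \<bar>n\<bar>) summable_on range (\<lambda>n. - int n)"
    by (subst summable_on_reindex) (use geom in \<open>auto simp: o_def inj_def\<close>)
  ultimately have "(\<lambda>n::int. r ^ nat \<bar>n\<bar>) summable_on (range int \<union> range (\<lambda>n. - int n))"
    by (rule summable_on_union)
  moreover have "range int \<union> range (\<lambda>n. - int n) = UNIV"
    by (metis (no_types, lifting) UNIV_eq_I UnI1 UnI2 int_cases2 rangeI)
  ultimately show ?thesis by simp
qed

text \<open>The terms with \<open>n \<ge> 0\<close> shrink with ratio \<open>lam\<close>, those with \<open>n < 0\<close> with ratio
  \<open>\<bar>B\<bar> / lam\<close>; the larger of the two governs both directions.\<close>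

definition series_ratio :: "real \<Rightarrow> real \<Rightarrow> real" where
  "series_ratio lam B = max lam (\<bar>B\<bar> / lam)"

text \<open>A summable bound for the terms of the series when the \<open>C\<^sup>1\<close> norm is at most 1.\<close>

definition series_majorant :: "real \<Rightarrow> real \<Rightarrow> real^'n \<Rightarrow> real \<Rightarrow> int \<Rightarrow> real" where
  "series_majorant lam B w \<sigma> n =
     (1 + (\<Sum>i\<in>UNIV. \<bar>w $ i\<bar>) / \<bar>\<sigma>\<bar>) * series_ratio lam B ^ nat \<bar>n\<bar>"

definition nonvanishing_series ::
    "real \<Rightarrow> real \<Rightarrow> real^'n \<Rightarrow> 'n::finite torus \<Rightarrow> nat \<Rightarrow> ('n torus \<Rightarrow> real) set" where
  "nonvanishing_series lam B w t0 m = {p \<in> C_torus m. \<exists>\<sigma>. \<sigma> \<noteq> 0 \<and>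
     series_fourier_coeff lam B (line_restriction p t0 w) \<sigma> \<noteq> 0}"

context
  fixes lam B :: real and w :: "real^'n" and t0 :: "'n torus"
  assumes lam: "0 < lam" "lam < 1" and B: "B \<noteq> 0" "\<bar>B\<bar> < lam"
begin

lemma series_majorant_nonneg: "0 \<le> series_majorant lam B w \<sigma> n"
  using lam by (auto simp: series_majorant_def series_ratio_def sum_nonneg intro!: mult_nonneg_nonneg add_nonneg_nonneg)

lemma series_majorant_summable: "series_majorant lam B w \<sigma> summable_on UNIV"
proof -
  have "0 \<le> series_ratio lam B" "series_ratio lam B < 1"
    using lam B by (auto simp: series_ratio_def)
  then show ?thesis
    unfolding series_majorant_def [abs_def]
    by (intro summable_on_cmult_right summable_on_power_nat_abs)
qed

text \<open>For \<open>n \<ge> 0\<close> the coefficients are bounded and \<open>lam\<^sup>n\<close> decays. For \<open>n = - k < 0\<close> the weight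
  \<open>lam\<^sup>-\<^sup>k\<close> grows, but the frequency \<open>\<sigma> B\<^sup>-\<^sup>k\<close> grows faster, and the decay of the coefficients
  at high frequency leaves the factor \<open>(\<bar>B\<bar> / lam)\<^sup>k\<close>. This is where \<open>\<bar>B\<bar> < lam\<close> is decisive.\<close>

lemma series_term_bound:
  assumes p: "p \<in> C_torus (Suc m)" and bd: "C1_bounded p M" and \<sigma>: "\<sigma> \<noteq> 0"
  shows "norm (of_real (lam powi n) * fourier_coeff (line_restriction p t0 w) (\<sigma> * B powi n))
    \<le> M * series_majorant lam B w \<sigma> n"
proof -
  let ?W = "\<Sum>i\<in>UNIV. \<bar>w $ i\<bar>"
  let ?c = "norm (fourier_coeff (line_restriction p t0 w) (\<sigma> * B powi n))"
  note coeff = fourier_coeff_line_bounds[OF p bd, where ?t0.0 = t0 and w = w and a = "\<sigma> * B powi n"]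
  have M: "M \<ge> 0"
    using coeff(1) norm_ge_zero order_trans by blast
  have W: "?W \<ge> 0"
    by (simp add: sum_nonneg)
  have "lam powi n * ?c \<le> M * ((1 + ?W / \<bar>\<sigma>\<bar>) * series_ratio lam B ^ nat \<bar>n\<bar>)"
  proof (cases "n \<ge> 0")
    case True
    have "lam powi n = lam ^ nat \<bar>n\<bar>"
      using True by (simp add: power_int_def)
    also have "\<dots> \<le> series_ratio lam B ^ nat \<bar>n\<bar>"
      using lam by (intro power_mono) (auto simp: series_ratio_def)
    finally have "lam powi n * ?c \<le> series_ratio lam B ^ nat \<bar>n\<bar> * M"
      using coeff(1) lam by (intro mult_mono) (auto simp: series_ratio_def)
    also have "\<dots> \<le> series_ratio lam B ^ nat \<bar>n\<bar> * (M * (1 + ?W / \<bar>\<sigma>\<bar>))"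
      using M W lam by (intro mult_left_mono) (auto simp: series_ratio_def algebra_simps)
    finally show ?thesis by (simp add: mult_ac)
  next
    case False
    define k where "k = nat \<bar>n\<bar>"
    have n: "n = - int k"
      using False by (simp add: k_def)
    have "\<bar>\<sigma>\<bar> * ?c \<le> M * ?W * \<bar>B\<bar> ^ k"
      using coeff(2) B(1) by (simp add: n power_int_minus abs_mult power_abs field_simps)
    then have "?c \<le> M * (?W / \<bar>\<sigma>\<bar>) * \<bar>B\<bar> ^ k"
      using \<sigma> by (simp add: field_simps)
    then have "lam powi n * ?c \<le> M * (?W / \<bar>\<sigma>\<bar>) * (\<bar>B\<bar> / lam) ^ k"
      using lam by (simp add: n power_int_minus power_divide field_simps)
    also have "\<dots> \<le> M * (1 + ?W / \<bar>\<sigma>\<bar>) * series_ratio lam B ^ k"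
      using M W lam by (intro mult_mono power_mono) (auto simp: series_ratio_def)
    finally show ?thesis
      by (simp add: k_def mult_ac)
  qed
  then show ?thesis
    using lam by (simp add: norm_mult norm_power_int series_majorant_def)
qed

lemma series_summable:
  assumes "p \<in> C_torus (Suc m)" "\<sigma> \<noteq> 0"
  shows "(\<lambda>n. of_real (lam powi n) * fourier_coeff (line_restriction p t0 w) (\<sigma> * B powi n))
    summable_on UNIV"
proof -
  obtain M where "C1_bounded p M"
    using C_torus_Suc_C1_bounded[OF assms(1)] by blast
  then have "(\<lambda>n. norm (complex_of_real (lam powi n) *
      fourier_coeff (line_restriction p t0 w) (\<sigma> * B powi n))) summable_on UNIV"
    using series_term_bound[OF assms(1) _ assms(2)]
    by (intro Infinite_Sum.abs_summable_on_comparison_test'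
        [OF summable_on_cmult_right[OF series_majorant_summable]])
  then show ?thesis
    by (rule Infinite_Sum.abs_summable_summable)
qed

lemma norm_series_fourier_coeff_le:
  assumes "p \<in> C_torus (Suc m)" "C1_bounded p M" "\<sigma> \<noteq> 0"
  shows "norm (series_fourier_coeff lam B (line_restriction p t0 w) \<sigma>)
    \<le> M * infsum (series_majorant lam B w \<sigma>) UNIV"
  unfolding series_fourier_coeff_def
proof (rule norm_infsum_le)
  show "((\<lambda>n. of_real (lam powi n) * fourier_coeff (line_restriction p t0 w) (\<sigma> * B powi n)) has_sum
      (\<Sum>\<^sub>\<infinity>n. of_real (lam powi n) * fourier_coeff (line_restriction p t0 w) (\<sigma> * B powi n))) UNIV"
    by (intro has_sum_infsum series_summable[OF assms(1,3)])
  show "((\<lambda>n. M * series_majorant lam B w \<sigma> n) has_sum (M * infsum (series_majorant lam B w \<sigma>) UNIV)) UNIV"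
    by (intro has_sum_cmult_right has_sum_infsum series_majorant_summable)
qed (rule series_term_bound[OF assms])

lemma series_fourier_coeff_add_cmult:
  assumes "p \<in> C_torus (Suc m)" "q \<in> C_torus (Suc m)" "\<sigma> \<noteq> 0"
  shows "series_fourier_coeff lam B (line_restriction (\<lambda>x. p x + c * q x) t0 w) \<sigma> =
    series_fourier_coeff lam B (line_restriction p t0 w) \<sigma> +
    of_real c * series_fourier_coeff lam B (line_restriction q t0 w) \<sigma>"
proof -
  let ?F = "\<lambda>p n. of_real (lam powi n) * fourier_coeff (line_restriction p t0 w) (\<sigma> * B powi n)"
  have "?F (\<lambda>x. p x + c * q x) n = ?F p n + of_real c * ?F q n" for n
    using fourier_coeff_add_cmult[OF almost_periodic_line_restriction[OF assms(1), of t0 w]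
        almost_periodic_line_restriction[OF assms(2), of t0 w], of c]
    by (simp add: line_restriction_def algebra_simps)
  moreover have "?F p summable_on UNIV" "?F q summable_on UNIV"
    using assms by (intro series_summable; simp)+
  ultimately show ?thesis
    unfolding series_fourier_coeff_def
    by (simp add: infsum_add summable_on_cmult_right infsum_cmult_right')
qed

text \<open>The coefficient is a linear functional that is bounded in the \<open>C\<^sup>1\<close> norm, and the
  \<open>C\<close>-topology of positive order is finer than that of the \<open>C\<^sup>1\<close> norm.\<close>

lemma openin_nonvanishing_coefficient:
  assumes \<sigma>: "\<sigma> \<noteq> 0"
  shows "openin (C_topology (Suc m)) {p \<in> C_torus (Suc m).
    series_fourier_coeff lam B (line_restriction p t0 w) \<sigma> \<noteq> 0}"
  unfolding openin_C_topology
proof (intro conjI ballI)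
  let ?\<Lambda> = "\<lambda>p. series_fourier_coeff lam B (line_restriction p t0 w) \<sigma>"
  let ?K = "infsum (series_majorant lam B w \<sigma>) UNIV"
  have K: "?K \<ge> 0"
    by (simp add: infsum_nonneg series_majorant_nonneg)
  fix p assume "p \<in> {p \<in> C_torus (Suc m). ?\<Lambda> p \<noteq> 0}"
  then have p: "p \<in> C_torus (Suc m)" "?\<Lambda> p \<noteq> 0" by auto
  \<comment> \<open>Only \<open>?K \<ge> 0\<close> is at hand; the summand 1 keeps the denominator positive.\<close>
  define e where "e = norm (?\<Lambda> p) / (?K + 1)"
  have "e > 0"
    using p(2) K by (simp add: e_def add_nonneg_pos)
  have "e * ?K < norm (?\<Lambda> p)"
    using p(2) K by (simp add: e_def field_simps add_nonneg_pos)
  have "?\<Lambda> q \<noteq> 0" if q: "q \<in> C_torus (Suc m)" "C_close (Suc m) e p q" for q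
  proof -
    have "norm (?\<Lambda> q + of_real (- 1) * ?\<Lambda> p) \<le> e * ?K"
      unfolding series_fourier_coeff_add_cmult[OF q(1) p(1) \<sigma>, symmetric]
      by (rule norm_series_fourier_coeff_le[OF C_torus_add_cmult[OF q(1) p(1)]
            C_close_C1_bounded_diff[OF p(1) q] \<sigma>])
    with \<open>e * ?K < norm (?\<Lambda> p)\<close> show ?thesis
      by auto
  qed
  with \<open>e > 0\<close> show "\<exists>e>0. \<forall>q\<in>C_torus (Suc m). C_close (Suc m) e p q \<longrightarrow>
      q \<in> {p \<in> C_torus (Suc m). ?\<Lambda> p \<noteq> 0}"
    by blast
qed auto

text \<open>A single cosine of frequency \<open>\<omega>\<close> has coefficients only at \<open>\<plusminus>\<omega>\<close>. As \<open>\<bar>B\<bar>\<close> is neither 0 nor 1,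
  the orbit \<open>\<omega> B\<^sup>n\<close> meets these only for \<open>n = 0\<close>.\<close>

lemma series_fourier_coeff_wave:
  assumes "w $ a \<noteq> 0"
  shows "series_fourier_coeff lam B (line_restriction (\<lambda>x. coordinate_wave a (x - t0)) t0 w)
    (2 * pi * w $ a) = 1/2"
proof -
  let ?\<omega> = "2 * pi * w $ a"
  have q: "line_restriction (\<lambda>x. coordinate_wave a (x - t0)) t0 w = (\<lambda>t. cos (?\<omega> * t))"
    by (simp add: line_restriction_def coordinate_wave_to_torus mult_ac)
  have "\<bar>B powi n\<bar> \<noteq> 1" if "n \<noteq> 0" for n
  proof -
    have "\<bar>B\<bar> ^ k \<noteq> 1" if "k > 0" for k
      using that lam B power_less_one_iff[of "\<bar>B\<bar>" k] by simp
    with that show ?thesis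
      by (cases n rule: int_cases2) (auto simp: power_int_minus power_abs)
  qed
  then have "of_real (lam powi n) * fourier_coeff (\<lambda>t. cos (?\<omega> * t)) (?\<omega> * B powi n) = 0"
    if "n \<noteq> 0" for n
    using that assms by (simp add: fourier_coeff_cos abs_mult)
  then have "series_fourier_coeff lam B (\<lambda>t. cos (?\<omega> * t)) ?\<omega> =
      (\<Sum>\<^sub>\<infinity>n\<in>{0}. of_real (lam powi n) * fourier_coeff (\<lambda>t. cos (?\<omega> * t)) (?\<omega> * B powi n))"
    unfolding series_fourier_coeff_def by (intro infsum_cong_neutral) auto
  also have "\<dots> = 1/2"
    using assms by (simp add: fourier_coeff_cos)
  finally show ?thesis
    by (simp add: q)
qed

lemma openin_nonvanishing_series: "openin (C_topology (Suc m)) (nonvanishing_series lam B w t0 (Suc m))"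
proof -
  have "nonvanishing_series lam B w t0 (Suc m) = (\<Union>\<sigma>\<in>-{0}. {p \<in> C_torus (Suc m).
      series_fourier_coeff lam B (line_restriction p t0 w) \<sigma> \<noteq> 0})"
    by (auto simp: nonvanishing_series_def)
  then show ?thesis
    by (auto intro!: openin_Union openin_nonvanishing_coefficient)
qed

text \<open>If all coefficients of the series vanish at \<open>p\<close>, then by linearity any nonzero multiple of a
  function with a nonvanishing coefficient moves \<open>p\<close> into the set, and a cosine in a coordinate
  that varies along the line is such a function.\<close>

lemma dense_nonvanishing_series:
  assumes "w \<noteq> 0"
  shows "C_topology (Suc m) closure_of nonvanishing_series lam B w t0 (Suc m) = topspace (C_topology (Suc m))"
  unfolding dense_intersects_open
proof (intro allI impI)
  fix T :: "('n torus \<Rightarrow> real) set"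
  assume T: "openin (C_topology (Suc m)) T \<and> T \<noteq> {}"
  then obtain p where "p \<in> T" by blast
  with T have p: "p \<in> C_torus (Suc m)"
    by (auto simp: openin_C_topology)
  show "nonvanishing_series lam B w t0 (Suc m) \<inter> T \<noteq> {}"
  proof (cases "p \<in> nonvanishing_series lam B w t0 (Suc m)")
    case True
    with \<open>p \<in> T\<close> show ?thesis by blast
  next
    case False
    obtain a where a: "w $ a \<noteq> 0"
      using assms by (auto simp: vec_eq_iff)
    let ?h = "\<lambda>x. coordinate_wave a (x - t0)"
    obtain e where e: "e > 0" "\<And>q. q \<in> C_torus (Suc m) \<Longrightarrow> C_close (Suc m) e p q \<Longrightarrow> q \<in> T"
      using T \<open>p \<in> T\<close> unfolding openin_C_topology by blast
    obtain M where M: "M > 0"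
      "\<And>is x. length is \<le> Suc m \<Longrightarrow> \<bar>iter_partial is (\<lambda>x. ?h (to_torus x)) x\<bar> \<le> M"
      using shifted_wave_derivatives_bounded by blast
    define c where "c = e / (2 * M)"
    define q where "q = (\<lambda>x. p x + c * ?h x)"
    have q: "q \<in> C_torus (Suc m)"
      unfolding q_def by (intro C_torus_add_cmult p shifted_wave_C_torus)
    have "q \<in> T"
      using e(2)[OF q] C_close_small_multiple[OF p shifted_wave_C_torus M(1) e(1) M(2)]
      by (simp add: q_def c_def)
    have "c \<noteq> 0"
      using e(1) M(1) by (simp add: c_def)
    have "2 * pi * w $ a \<noteq> 0"
      using a by simp
    then have "series_fourier_coeff lam B (line_restriction p t0 w) (2 * pi * w $ a) = 0"
      using False p unfolding nonvanishing_series_def by blast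
    then have "series_fourier_coeff lam B (line_restriction q t0 w) (2 * pi * w $ a) = of_real c / 2"
      unfolding q_def using a
      by (subst series_fourier_coeff_add_cmult[OF p shifted_wave_C_torus])
         (simp_all add: series_fourier_coeff_wave)
    then have "q \<in> nonvanishing_series lam B w t0 (Suc m)"
      using a q \<open>c \<noteq> 0\<close> unfolding nonvanishing_series_def
      by (intro CollectI conjI exI[of _ "2 * pi * w $ a"]) auto
    with \<open>q \<in> T\<close> show ?thesis by blast
  qed
qed

end

section \<open>Finite intersections and the theorem\<close>

lemma finite_Int_open_dense:
  assumes "finite I" "\<And>i. i \<in> I \<Longrightarrow> openin X (S i)"
    "\<And>i. i \<in> I \<Longrightarrow> X closure_of S i = topspace X"
  shows "openin X (topspace X \<inter> \<Inter> (S ` I)) \<and>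
    X closure_of (topspace X \<inter> \<Inter> (S ` I)) = topspace X"
  using assms
proof (induction I)
  case (insert i I)
  let ?U = "topspace X \<inter> \<Inter> (S ` I)"
  have U: "openin X ?U" "X closure_of ?U = topspace X"
    using insert by auto
  have S: "openin X (S i)" "X closure_of (S i) = topspace X"
    using insert.prems by auto
  have eq: "topspace X \<inter> \<Inter> (S ` insert i I) = S i \<inter> ?U"
    by auto
  have "(S i \<inter> ?U) \<inter> T \<noteq> {}" if "openin X T" "T \<noteq> {}" for T
  proof -
    have "?U \<inter> T \<noteq> {}" "openin X (?U \<inter> T)"
      using U that by (auto simp: dense_intersects_open simp del: Int_iff)
    then have "S i \<inter> (?U \<inter> T) \<noteq> {}"
      using S(2) unfolding dense_intersects_open by blast
    then show ?thesis by (simp add: Int_assoc)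
  qed
  then have "X closure_of (S i \<inter> ?U) = topspace X"
    unfolding dense_intersects_open by blast
  then show ?case
    unfolding eq using S(1) U(1) by (simp add: openin_Int)
qed auto

lemma anosov_matrix_eigenvalue_nonzero:
  assumes "anosov_matrix A" "x \<noteq> 0" "A *v x = b *\<^sub>R x"
  shows "b \<noteq> 0"
proof
  assume "b = 0"
  have "invertible A"
    using assms(1) by (auto simp: anosov_matrix_def invertible_det_nz)
  then have "inj ((*v) A)"
    by (rule inj_matrix_vector_mult)
  moreover have "A *v x = A *v 0"
    using \<open>b = 0\<close> assms(3) by simp
  ultimately have "x = 0"
    by (rule injD)
  with assms(2) show False by contradiction
qed

theorem theorem3p9:
  fixes A :: "real^'n^'n" and B :: "nat \<Rightarrow> real" and v :: "nat \<Rightarrow> real^'n"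
    and lam :: real and t0 :: "'n torus" and k j l :: nat
  assumes "CARD('n) = k" and "k > 2"
    and "anosov_matrix A"
    and "\<forall>i\<in>{1..k}. v i \<noteq> 0 \<and> A *v v i = B i *\<^sub>R v i"
    and "inj_on v {1..k}" and "independent (v ` {1..k})" and "span (v ` {1..k}) = UNIV"
    and "1 \<le> j" and "j < k"
    and "\<forall>i\<in>{1..<k}. \<bar>B i\<bar> < \<bar>B (i + 1)\<bar>"
    and "\<bar>B j\<bar> < 1" and "1 < \<bar>B (j + 1)\<bar>"
    and "0 < lam" and "lam < 1"
    and "2 \<le> l" and "l < k"
    and "\<bar>B l\<bar> < lam" and "lam < \<bar>B (l + 1)\<bar>"
  shows "let S = {p \<in> C_torus (k + 1). \<forall>i\<in>{1..l}. \<exists>\<sigma>. \<sigma> \<noteq> 0 \<and>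
                   series_fourier_coeff lam (B i) (line_restriction p t0 (v i)) \<sigma> \<noteq> 0}
         in (\<exists>p. p \<in> S) \<and>
            openin (C_topology (k + 1)) S \<and>
            C_topology (k + 1) closure_of S = topspace (C_topology (k + 1))"
proof -
  let ?X = "C_topology (Suc k) :: ('n torus \<Rightarrow> real) topology"
  let ?S = "\<lambda>i. nonvanishing_series lam (B i) (v i) t0 (Suc k)"
  have eigen: "v i \<noteq> 0" "B i \<noteq> 0" "\<bar>B i\<bar> < lam" if "i \<in> {1..l}" for i
  proof -
    have i: "i \<in> {1..k}"
      using that \<open>l < k\<close> by simp
    then show "v i \<noteq> 0"
      using assms(4) by blast
    show "B i \<noteq> 0"
      using anosov_matrix_eigenvalue_nonzero assms(3,4) i by blast
    have "\<bar>B i\<bar> \<le> \<bar>B l\<bar>"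
    proof (rule inc_induct[of i l "\<lambda>n. \<bar>B n\<bar> \<le> \<bar>B l\<bar>"])
      fix n assume "i \<le> n" "n < l" "\<bar>B (Suc n)\<bar> \<le> \<bar>B l\<bar>"
      moreover have "\<bar>B n\<bar> < \<bar>B (n + 1)\<bar>"
        using assms(10) that \<open>i \<le> n\<close> \<open>n < l\<close> \<open>l < k\<close> by simp
      ultimately show "\<bar>B n\<bar> \<le> \<bar>B l\<bar>" by simp
    qed (use that in auto)
    then show "\<bar>B i\<bar> < lam"
      using \<open>\<bar>B l\<bar> < lam\<close> by simp
  qed
  define S where "S = topspace ?X \<inter> \<Inter> (?S ` {1..l})"
  have S: "openin ?X S" "?X closure_of S = topspace ?X"
    unfolding S_def
    using finite_Int_open_dense[of "{1..l}" ?X ?S]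
      openin_nonvanishing_series[OF assms(13,14) eigen(2,3)]
      dense_nonvanishing_series[OF assms(13,14) eigen(2,3,1)]
    by blast+
  have "topspace ?X \<noteq> {}"
    using shifted_wave_C_torus by (auto simp: topspace_C_topology)
  then have "S \<noteq> {}"
    using S(2) by (metis closure_of_empty)
  moreover have "S = {p \<in> C_torus (k + 1). \<forall>i\<in>{1..l}. \<exists>\<sigma>. \<sigma> \<noteq> 0 \<and>
      series_fourier_coeff lam (B i) (line_restriction p t0 (v i)) \<sigma> \<noteq> 0}"
    by (auto simp: S_def topspace_C_topology
        nonvanishing_series_def)
  ultimately show ?thesis
    using S by (auto simp: Let_def)
qed

end
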